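(* Let $R$ be a commutative Frobenius ring with unity and with a fixed non-trivial involutory ring automorphism $x\mapsto\overline{x}$. Let $n\in\mathbb{N}$, let $\lambda,\mu\in R$ satisfy $\lambda\overline{\lambda}=\mu\overline{\mu}=1$, let $\mathbf{a},\mathbf{b},\mathbf{c}\in R^n$, and put $A=\mathrm{circ}_\lambda(\mathbf{a})$, $B=\mathrm{circ}_\lambda(\mathbf{b})$, $C=\mathrm{circ}_\mu(\mathbf{c})$, $J=J_n$. Let $$G=\begin{pmatrix} I_{2n} & X\end{pmatrix},\qquad X=\begin{pmatrix} -A^TCJ & -\overline{B}\\ B^TCJ & -\overline{A}\end{pmatrix}.$$ Then $G$ is a generator matrix of a Hermitian self-dual $[4n,2n]$-code over $R$ (i.e. the $R$-submodule of $R^{4n}$ generated by the rows of $G$ is Hermitian self-dual) if and only if $$\Theta(\mathbf{a},\overline{\mathbf{a}},j)[\overline{\lambda}]+\Theta(\mathbf{b},\overline{\mathbf{b}},j)[\overline{\lambda}]=\begin{cases}-1,& j=0,\\ 0,& j\in\{1,\dots,\lfloor n/2\rfloor\},\end{cases}$$ and $$\Theta(\mathbf{c},\overline{\mathbf{c}},j)[\overline{\mu}]=\begin{cases}1,& j=0,\\ 0,& j\in\{1,\dots,\lfloor n/2\rfloor\}.\end{cases}$$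
   Context: For a matrix $M$ over $R$, $\overline{M}$ denotes entrywise application of the involution. For $\nu\in R$ and $\mathbf{v}=(v_0,\dots,v_{n-1})\in R^n$, $\mathrm{circ}_\nu(\mathbf{v})$ is the $n\times n$ $\nu$-circulant matrix whose first row is $\mathbf{v}$ and each subsequent row is the previous row shifted cyclically one place to the right, with the entry wrapped around to the first position multiplied by $\nu$; i.e. $\mathrm{circ}_\nu(\mathbf{v})=\sum_{i=0}^{n-1}v_iP_\nu^i$ with $P_\nu=\begin{pmatrix}\mathbf{0}& I_{n-1}\\ \nu & \mathbf{0}\end{pmatrix}$. $J_n$ is the $n\times n$ exchange matrix (entry $(i,j)$ equals $1$ if $i+j=n+1$ and $0$ otherwise). For $\mathbf{x},\mathbf{y}\in R^n$ and $\mathbf{x}=(x_0,\dots,x_{n-1})$, $\mathbf{y}=(y_0,\dots,y_{n-1})$, $j\in\{0,\dots,n-1\}$ and $\nu\in R$: $\Theta(\mathbf{x},\mathbf{y},j)[\nu]=\sum_{i=0}^{n-j-1}x_{[i+j]_n}y_i+\nu\sum_{i=n-j}^{n-1}x_{[i+j]_n}y_i$, where $[m]_n\in\{0,\dots,n-1\}$ is the residue of $m$ modulo $n$; for $j=0$ this is $\sum_i x_iy_i$. The Hermitian inner product on $R^N$ is $\langle\mathbf{x},\mathbf{y}\rangle_H=\sum_i x_i\overline{y_i}$, the Hermitian dual of a code $\mathcal{C}\subseteq R^N$ is $\mathcal{C}^{\perp_H}=\{\mathbf{x}:\langle\mathbf{x},\mathbf{y}\rangle_H=0\ \forall\mathbf{y}\in\mathcal{C}\}$,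 and $\mathcal{C}$ is Hermitian self-dual if $\mathcal{C}=\mathcal{C}^{\perp_H}$. *)

theory Defs
  imports "Jordan_Normal_Form.VS_Connect" "HOL-Algebra.QuotRing"
begin

section \<open>Commutative Frobenius rings\<close>

definition dcc_ideals :: "('a, 'b) ring_scheme \<Rightarrow> bool" where
  "dcc_ideals R \<longleftrightarrow> (\<nexists>I :: nat \<Rightarrow> 'a set. \<forall>k. ideal (I k) R \<and> I (Suc k) \<subset> I k)"

definition jacobson_radical :: "('a, 'b) ring_scheme \<Rightarrow> 'a set" where
  "jacobson_radical R = carrier R \<inter> \<Inter> {M. maximalideal M R}"

definition minimal_ideal :: "'a set \<Rightarrow> ('a, 'b) ring_scheme \<Rightarrow> bool" where
  "minimal_ideal I R \<longleftrightarrow>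
     ideal I R \<and> I \<noteq> {\<zero>\<^bsub>R\<^esub>} \<and> (\<forall>K. ideal K R \<and> K \<subseteq> I \<longrightarrow> K = {\<zero>\<^bsub>R\<^esub>} \<or> K = I)"

definition socle :: "('a, 'b) ring_scheme \<Rightarrow> 'a set" where
  "socle R = genideal R (\<Union> {I. minimal_ideal I R})"

text \<open>A commutative ring is Frobenius if it is Artinian and its socle is isomorphic, as a module
  over the ring, to the quotient by the Jacobson radical. The scalar \<open>r\<close> acts on the quotient as
  multiplication by the coset of \<open>r\<close>. The ring is not required to be finite.\<close>

definition comm_frobenius_ring :: "('a, 'b) ring_scheme \<Rightarrow> bool" where
  "comm_frobenius_ring R \<longleftrightarrow> cring R \<and> dcc_ideals R \<and>
     (let J = jacobson_radical R; Q = R Quot J in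
       \<exists>\<phi>. bij_betw \<phi> (carrier Q) (socle R) \<and>
           (\<forall>x\<in>carrier Q. \<forall>y\<in>carrier Q. \<phi> (x \<oplus>\<^bsub>Q\<^esub> y) = \<phi> x \<oplus>\<^bsub>R\<^esub> \<phi> y) \<and>
           (\<forall>r\<in>carrier R. \<forall>x\<in>carrier Q. \<phi> ((J +>\<^bsub>R\<^esub> r) \<otimes>\<^bsub>Q\<^esub> x) = r \<otimes>\<^bsub>R\<^esub> \<phi> x))"

definition nontrivial_involution :: "('a, 'b) ring_scheme \<Rightarrow> ('a \<Rightarrow> 'a) \<Rightarrow> bool" where
  "nontrivial_involution R \<sigma> \<longleftrightarrow> \<sigma> \<in> ring_iso R R \<and>
     (\<forall>x\<in>carrier R. \<sigma> (\<sigma> x) = x) \<and> (\<exists>x\<in>carrier R. \<sigma> x \<noteq> x)"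


section \<open>Codes\<close>

text \<open>In this section and the next, \<open>\<sigma>\<close> is the involution of the coefficient ring.\<close>

definition row_module :: "'a::comm_ring_1 mat \<Rightarrow> 'a vec set" where
  "row_module G = LinearCombinations.module.span class_ring
     (module_vec TYPE('a) (dim_col G)) (set (rows G))"

definition hermitian_inner :: "('a \<Rightarrow> 'a) \<Rightarrow> 'a::comm_ring_1 vec \<Rightarrow> 'a vec \<Rightarrow> 'a" where
  "hermitian_inner \<sigma> x y = x \<bullet> map_vec \<sigma> y"

definition hermitian_dual :: "('a \<Rightarrow> 'a) \<Rightarrow> nat \<Rightarrow> 'a::comm_ring_1 vec set \<Rightarrow> 'a vec set" where
  "hermitian_dual \<sigma> N \<C> = {x \<in> carrier_vec N. \<forall>y\<in>\<C>. hermitian_inner \<sigma> x y = 0}"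

definition hermitian_self_dual :: "('a \<Rightarrow> 'a) \<Rightarrow> nat \<Rightarrow> 'a::comm_ring_1 vec set \<Rightarrow> bool" where
  "hermitian_self_dual \<sigma> N \<C> \<longleftrightarrow> \<C> = hermitian_dual \<sigma> N \<C>"


section \<open>Matrices\<close>

definition append_cols :: "'a::zero mat \<Rightarrow> 'a mat \<Rightarrow> 'a mat" where
  "append_cols A B = four_block_mat A B (0\<^sub>m 0 (dim_col A)) (0\<^sub>m 0 (dim_col B))"

definition nu_shift :: "'a::comm_ring_1 \<Rightarrow> 'a vec \<Rightarrow> 'a vec" where
  "nu_shift \<nu> v = vec (dim_vec v)
     (\<lambda>j. if j = 0 then \<nu> * v $ (dim_vec v - 1) else v $ (j - 1))"

definition circ :: "'a::comm_ring_1 \<Rightarrow> 'a vec \<Rightarrow> 'a mat" where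
  "circ \<nu> v = mat_of_rows (dim_vec v) (map (\<lambda>i. (nu_shift \<nu> ^^ i) v) [0..<dim_vec v])"

text \<open>Indices of matrices and vectors start at 0, so the antidiagonal is \<open>i + j = n - 1\<close>.\<close>

definition exchange_mat :: "nat \<Rightarrow> 'a::comm_ring_1 mat" where
  "exchange_mat n = mat n n (\<lambda>(i, j). if i + j + 1 = n then 1 else 0)"

definition Theta :: "'a::comm_ring_1 vec \<Rightarrow> 'a vec \<Rightarrow> nat \<Rightarrow> 'a \<Rightarrow> 'a" where
  "Theta x y j \<nu> = (let n = dim_vec x in
     (\<Sum>i = 0..<n - j. x $ ((i + j) mod n) * y $ i) +
     \<nu> * (\<Sum>i = n - j..<n. x $ ((i + j) mod n) * y $ i))"

lemma dim_nu_shift_pow [simp]: "dim_vec ((nu_shift \<nu> ^^ i) v) = dim_vec v"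
  by (induction i) (simp_all add: nu_shift_def)

lemma nu_shift_pow_index:
  assumes "i \<le> dim_vec v" "j < dim_vec v"
  shows "(nu_shift \<nu> ^^ i) v $ j =
    (if i \<le> j then v $ (j - i) else \<nu> * v $ (dim_vec v + j - i))"
  using assms
proof (induction i arbitrary: j)
  case (Suc i)
  have "(nu_shift \<nu> ^^ Suc i) v $ j =
      (if j = 0 then \<nu> * (nu_shift \<nu> ^^ i) v $ (dim_vec v - 1)
       else (nu_shift \<nu> ^^ i) v $ (j - 1))"
    using Suc.prems by (simp add: nu_shift_def)
  then show ?case
    using Suc.prems Suc.IH[of "dim_vec v - 1"] Suc.IH[of "j - 1"]
    by (auto simp: not_le less_Suc_eq_le)
qed simp

lemma circ_carrier [simp]: "circ \<nu> v \<in> carrier_mat (dim_vec v) (dim_vec v)"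
  by (simp add: circ_def mat_of_rows_def)

lemma circ_index:
  assumes "i < dim_vec v" "j < dim_vec v"
  shows "circ \<nu> v $$ (i, j) =
    (if i \<le> j then v $ (j - i) else \<nu> * v $ (dim_vec v + j - i))"
  using assms by (simp add: circ_def mat_of_rows_index nu_shift_pow_index)

end

theory Submission
  imports Defs
begin

text \<open>Write \<open>M\<^sup>*\<close> for the conjugate transpose and \<open>M\<^sup>c\<close> for the entrywise conjugate. The code generated by
  \<open>(I X)\<close> is Hermitian self-dual iff \<open>X\<^sup>* X = -I\<close>. Since \<open>\<lambda>\<close>-circulant matrices commute with each other,
  and \<open>A\<^sup>c\<close>, \<open>B\<^sup>c\<close>, \<open>A\<^sup>T\<close>, \<open>B\<^sup>T\<close> are all circulant for the conjugate of \<open>\<lambda>\<close>, the product \<open>X\<^sup>* X\<close> is block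
  diagonal with blocks \<open>J C\<^sup>* H C J\<close> and \<open>H\<close>, where \<open>H = A\<^sup>c A\<^sup>T + B\<^sup>c B\<^sup>T\<close>; so the condition is \<open>H = -I\<close> and
  \<open>C\<^sup>* C = I\<close>, the latter being equivalent to \<open>C\<^sup>c C\<^sup>T = I\<close>. The first columns of \<open>H\<close> and \<open>C\<^sup>c C\<^sup>T\<close> consist
  of the values of \<open>\<Theta>\<close>, and a Hermitian circulant matrix is determined by half of its first column.\<close>

section \<open>One-sided inverses of square matrices\<close>

text \<open>Determinants give \<open>det B * det A = 1\<close>, so the adjugate of \<open>A\<close>
  scaled by \<open>det B\<close> is a left inverse \<open>L\<close>, and then
  \<open>L = L * (A * B) = B\<close>.\<close>

lemma mat_mult_one_commute:
  fixes A B :: "'a::comm_ring_1 mat"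
  assumes A: "A \<in> carrier_mat n n" and B: "B \<in> carrier_mat n n" and AB: "A * B = 1\<^sub>m n"
  shows "B * A = 1\<^sub>m n"
proof -
  define L where "L = det B \<cdot>\<^sub>m adj_mat A"
  have L: "L \<in> carrier_mat n n" using adj_mat(1)[OF A] by (simp add: L_def)
  have "det B * det A = 1"
    using det_mult[OF A B] AB by (simp add: mult.commute)
  then have LA: "L * A = 1\<^sub>m n"
    using adj_mat[OF A] A
    by (intro eq_matI) (auto simp: L_def mult_smult_assoc_mat[of _ n n _ n] simp flip: mult.assoc)
  have "B = (L * A) * B" using B by (simp add: LA)
  also have "\<dots> = L" using A B L AB by (simp add: assoc_mult_mat[of _ n n _ n _ n])
  finally show ?thesis using LA by simp
qed

lemma mat_mult_minus_one_commute:
  fixes A B :: "'a::comm_ring_1 mat"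
  assumes A: "A \<in> carrier_mat n n" and B: "B \<in> carrier_mat n n" and AB: "A * B = - 1\<^sub>m n"
  shows "B * A = - 1\<^sub>m n"
proof -
  have "- A * B = 1\<^sub>m n" using AB A B by simp
  then have "B * - A = 1\<^sub>m n" using mat_mult_one_commute[of "- A" n B] A B by simp
  then have "- (B * A) = 1\<^sub>m n" using A B by simp
  then show ?thesis by (metis uminus_uminus_mat)
qed

section \<open>Codes generated by \<open>(I X)\<close> and their Hermitian duals\<close>

text \<open>The span is taken over the set of rows, where equal rows coincide. Passing to
  combinations of the list of rows, with coefficients indexed by position, turns it into the image
  of \<open>G\<^sup>T\<close>.\<close>

lemma row_module_eq:
  fixes G :: "'a::comm_ring_1 mat"
  assumes G: "G \<in> carrier_mat nr nc"
  shows "row_module G = {G\<^sup>T *\<^sub>v u | u. u \<in> carrier_vec nr}"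
proof -
  interpret vec_module "TYPE('a)" nc .
  have rows: "set (rows G) \<subseteq> carrier_vec nc" using G by (auto simp: rows_def)
  have lincomb_list: "lincomb_list f (rows G) = G\<^sup>T *\<^sub>v vec nr f" for f
    using lincomb_list_as_mat_mult[of "rows G" f] rows G
    by (auto simp flip: cols_transpose simp: mat_of_cols_cols[of "G\<^sup>T" , simplified] subset_iff)
  have vec: "\<exists>f. u = vec nr f" if "u \<in> carrier_vec nr" for u :: "'a vec"
    using that by (intro exI[of _ "vec_index u"]) auto
  have "span (set (rows G)) = {lincomb f (set (rows G)) | f. True}"
    using finite_span[of "set (rows G)"] rows by simp
  also have "\<dots> = {lincomb_list f (rows G) | f. True}"
    using lincomb_as_lincomb_list[OF rows] lincomb_list_as_lincomb[OF rows] by fastforce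
  also have "\<dots> = {G\<^sup>T *\<^sub>v u | u. u \<in> carrier_vec nr}"
    unfolding lincomb_list using vec by fastforce
  finally show ?thesis
    using G by (simp add: row_module_def)
qed

locale ring_involution = comm_ring_hom hom
  for hom :: "'a::comm_ring_1 \<Rightarrow> 'a" +
  assumes hom_hom [simp]: "hom (hom x) = x"
begin

abbreviation adj :: "'a mat \<Rightarrow> 'a mat" where
  "adj M \<equiv> (mat\<^sub>h M)\<^sup>T"

lemma mat_hom_mat_hom [simp]: "mat\<^sub>h (mat\<^sub>h M) = M"
  by (rule eq_matI) auto

text \<open>With \<open>Y\<close> the conjugate of \<open>X\<close>, the code consists of the words
  \<open>(u, X\<^sup>T u)\<close> and its dual of the words \<open>(y, z)\<close> with
  \<open>y = - Y z\<close>. Equality of the two forces \<open>Y X\<^sup>T = -I\<close>. Conversely,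
  \<open>Y X\<^sup>T = -I\<close> puts the code into the dual, and \<open>X\<^sup>T Y = -I\<close>
  puts the dual into the code. For square matrices the two equations are equivalent, and conjugating
  the second gives \<open>X\<^sup>* X = -I\<close>.\<close>

lemma hermitian_self_dual_iff:
  assumes X: "X \<in> carrier_mat m m"
  shows "hermitian_self_dual hom (m + m) (row_module (append_cols (1\<^sub>m m) X)) \<longleftrightarrow>
    adj X * X = - 1\<^sub>m m"
proof -
  let ?G = "append_cols (1\<^sub>m m) X"
  let ?C = "row_module ?G" and ?Y = "mat\<^sub>h X"
  have Y: "?Y \<in> carrier_mat m m" and XT: "X\<^sup>T \<in> carrier_mat m m" using X by auto
  have G: "?G \<in> carrier_mat m (m + m)" using X by (auto simp: append_cols_def)
  have word: "?G\<^sup>T *\<^sub>v u = u @\<^sub>v (X\<^sup>T *\<^sub>v u)" if u: "u \<in> carrier_vec m" for u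
  proof (rule eq_vecI)
    fix i assume i: "i < dim_vec (u @\<^sub>v (X\<^sup>T *\<^sub>v u))"
    have "col ?G i = (if i < m then unit_vec m i else col X (i - m))"
      using i u X by (intro eq_vecI) (auto simp: append_cols_def unit_vec_def)
    then show "(?G\<^sup>T *\<^sub>v u) $ i = (u @\<^sub>v (X\<^sup>T *\<^sub>v u)) $ i"
      using i u X G by auto
  qed (use u X G in auto)
  have code: "?C = {u @\<^sub>v (X\<^sup>T *\<^sub>v u) | u. u \<in> carrier_vec m}"
    unfolding row_module_eq[OF G] setcompr_eq_image by (intro image_cong) (auto simp: word)
  \<comment> \<open>Moving the transpose of \<open>Y\<close> to the other factor merges both halves
    into one product with the conjugate of \<open>u\<close>.\<close>
  have inner: "hermitian_inner hom (y @\<^sub>v z) (u @\<^sub>v (X\<^sup>T *\<^sub>v u)) = (y + ?Y *\<^sub>v z) \<bullet> vec\<^sub>h u"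
    if "y \<in> carrier_vec m" "z \<in> carrier_vec m" "u \<in> carrier_vec m" for y z u
  proof -
    have "vec\<^sub>h (u @\<^sub>v (X\<^sup>T *\<^sub>v u)) = vec\<^sub>h u @\<^sub>v vec\<^sub>h (X\<^sup>T *\<^sub>v u)"
      by (rule eq_vecI) auto
    also have "vec\<^sub>h (X\<^sup>T *\<^sub>v u) = ?Y\<^sup>T *\<^sub>v vec\<^sub>h u"
      using that XT by (simp add: mult_mat_vec_hom map_mat_transpose)
    finally have "hermitian_inner hom (y @\<^sub>v z) (u @\<^sub>v (X\<^sup>T *\<^sub>v u)) =
        y \<bullet> vec\<^sub>h u + z \<bullet> (?Y\<^sup>T *\<^sub>v vec\<^sub>h u)"
      using that Y by (simp add: hermitian_inner_def scalar_prod_append[of _ m _ m])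
    also have "z \<bullet> (?Y\<^sup>T *\<^sub>v vec\<^sub>h u) = (?Y *\<^sub>v z) \<bullet> vec\<^sub>h u"
      using that Y transpose_vec_mult_scalar[of "?Y\<^sup>T" m m "vec\<^sub>h u" z] by simp
    finally show ?thesis using that Y by (simp add: add_scalar_prod_distrib[of _ m])
  qed
  have dual: "y @\<^sub>v z \<in> hermitian_dual hom (m + m) ?C \<longleftrightarrow> y = - (?Y *\<^sub>v z)"
    if y: "y \<in> carrier_vec m" and z: "z \<in> carrier_vec m" for y z
  proof
    assume "y @\<^sub>v z \<in> hermitian_dual hom (m + m) ?C"
    then have 0: "(y + ?Y *\<^sub>v z) \<bullet> vec\<^sub>h u = 0" if "u \<in> carrier_vec m" for u
      using that inner[OF y z that] by (auto simp: hermitian_dual_def code)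
    have "(y + ?Y *\<^sub>v z) $ i = 0" if "i < m" for i
    proof -
      \<comment> \<open>The involution fixes 0 and 1, hence unit vectors, and pairing with these
        reads off coordinates.\<close>
      have "vec\<^sub>h (unit_vec m i) = unit_vec m i" by (rule eq_vecI) (auto simp: unit_vec_def)
      then show ?thesis using 0[of "unit_vec m i"] that y z Y by simp
    qed
    then show "y = - (?Y *\<^sub>v z)"
      using y z Y by (intro eq_vecI) (auto simp: eq_neg_iff_add_eq_0)
  next
    assume "y = - (?Y *\<^sub>v z)"
    then have "y + ?Y *\<^sub>v z = 0\<^sub>v m" using y z Y by auto
    then show "y @\<^sub>v z \<in> hermitian_dual hom (m + m) ?C"
      using inner[OF y z] y z by (auto simp: hermitian_dual_def code)
  qed
  have mult_vec: "?Y *\<^sub>v (X\<^sup>T *\<^sub>v u) = (?Y * X\<^sup>T) *\<^sub>v u" if "u \<in> carrier_vec m" for u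
    using that X Y by (simp add: assoc_mult_mat_vec[of _ m m _ m])
  have conj: "adj X * X = mat\<^sub>h (X\<^sup>T * ?Y)"
    using X Y by (simp add: mat_hom_mult[of _ m m _ m] map_mat_transpose)
  have neg_one: "mat\<^sub>h (- 1\<^sub>m m) = - 1\<^sub>m m" by (rule eq_matI) (auto simp: hom_uminus)
  have step1: "?Y * X\<^sup>T = - 1\<^sub>m m" if sd: "?C = hermitian_dual hom (m + m) ?C"
  proof (rule eq_matI)
    fix i j assume "i < dim_row (- 1\<^sub>m m :: 'a mat)" "j < dim_col (- 1\<^sub>m m :: 'a mat)"
    then have ij: "i < m" "j < m" by auto
    \<comment> \<open>The codeword of this unit vector lies in the dual, and its first half yields
      column \<open>j\<close> of \<open>Y X\<^sup>T\<close>.\<close>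
    let ?e = "unit_vec m j"
    have e: "?e \<in> carrier_vec m" "X\<^sup>T *\<^sub>v ?e \<in> carrier_vec m" using X by auto
    then have "?e @\<^sub>v (X\<^sup>T *\<^sub>v ?e) \<in> hermitian_dual hom (m + m) ?C"
      using sd unfolding code by auto
    then have "?e = - ((?Y * X\<^sup>T) *\<^sub>v ?e)"
      unfolding dual[OF e] mult_vec[OF e(1)] .
    then have "?e $ i = (- ((?Y * X\<^sup>T) *\<^sub>v ?e)) $ i" by (rule arg_cong)
    moreover have "(- (Z *\<^sub>v ?e)) $ i = - (Z $$ (i, j))" if "Z \<in> carrier_mat m m" for Z :: "'a mat"
      using that ij by simp
    ultimately have "?e $ i = - ((?Y * X\<^sup>T) $$ (i, j))"
      using mult_carrier_mat[OF Y XT] by metis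
    then show "(?Y * X\<^sup>T) $$ (i, j) = (- 1\<^sub>m m) $$ (i, j)"
      using ij X Y by (auto simp: unit_vec_def)
  qed (use X in auto)
  have step2: "?C = hermitian_dual hom (m + m) ?C"
    if YX: "?Y * X\<^sup>T = - 1\<^sub>m m" and XY: "X\<^sup>T * ?Y = - 1\<^sub>m m"
  proof (intro equalityI subsetI)
    fix x assume "x \<in> ?C"
    then obtain u where u: "u \<in> carrier_vec m" "x = u @\<^sub>v (X\<^sup>T *\<^sub>v u)" by (auto simp: code)
    have "- (?Y *\<^sub>v (X\<^sup>T *\<^sub>v u)) = u" using u by (simp add: mult_vec YX)
    then show "x \<in> hermitian_dual hom (m + m) ?C" using u dual[of u "X\<^sup>T *\<^sub>v u"] X by simp
  next
    fix x assume x: "x \<in> hermitian_dual hom (m + m) ?C"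
    define y z where "y = vec_first x m" and "z = vec_last x m"
    have yz: "y \<in> carrier_vec m" "z \<in> carrier_vec m" "x = y @\<^sub>v z"
      using x by (auto simp: y_def z_def hermitian_dual_def)
    then have y: "y = - (?Y *\<^sub>v z)" using dual x by simp
    have "X\<^sup>T *\<^sub>v y = - ((X\<^sup>T * ?Y) *\<^sub>v z)"
      unfolding y using yz X Y XT
      by (intro eq_vecI) (simp_all add: assoc_mult_mat_vec[of _ m m _ m])
    also have "\<dots> = z" using yz by (simp add: XY)
    finally show "x \<in> ?C" using yz by (auto simp: code)
  qed
  have "?C = hermitian_dual hom (m + m) ?C \<longleftrightarrow> X\<^sup>T * ?Y = - 1\<^sub>m m"
    using step1 step2 mat_mult_minus_one_commute[OF Y XT] mat_mult_minus_one_commute[OF XT Y] by blast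
  also have "\<dots> \<longleftrightarrow> adj X * X = - 1\<^sub>m m"
    unfolding conj using neg_one mat_hom_mat_hom by metis
  finally show ?thesis by (simp add: hermitian_self_dual_def)
qed

end

section \<open>The shift matrix and the matrices commuting with it\<close>

text \<open>This is the matrix \<open>P\<^sub>\<nu>\<close>. Recognizing the last row by the failure
  of \<open>i + 1 < n\<close> also covers \<open>n = 1\<close>, where the single entry is
  \<open>\<nu>\<close>.\<close>

definition shift_mat :: "'a::comm_ring_1 \<Rightarrow> nat \<Rightarrow> 'a mat" where
  "shift_mat \<nu> n = mat n n (\<lambda>(i, j).
     if i + 1 < n then if j = i + 1 then 1 else 0 else if j = 0 then \<nu> else 0)"

lemma shift_mat_carrier [simp]: "shift_mat \<nu> n \<in> carrier_mat n n"
  by (simp add: shift_mat_def)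

lemma dim_shift_mat [simp]: "dim_row (shift_mat \<nu> n) = n" "dim_col (shift_mat \<nu> n) = n"
  by (simp_all add: shift_mat_def)

text \<open>Each row of \<open>P\<^sub>\<nu>\<close> has only one position that can be nonzero, so
  one term of the sum survives.\<close>

lemma shift_mat_mult_index:
  assumes "M \<in> carrier_mat n m" "i < n" "j < m"
  shows "(shift_mat \<nu> n * M) $$ (i, j) = (if i + 1 < n then M $$ (i + 1, j) else \<nu> * M $$ (0, j))"
proof -
  have "(shift_mat \<nu> n * M) $$ (i, j) = (\<Sum>k = 0..<n. shift_mat \<nu> n $$ (i, k) * M $$ (k, j))"
    using assms by (auto simp: scalar_prod_def intro!: sum.cong)
  also have "\<dots> = (\<Sum>k = 0..<n. if k = (if i + 1 < n then i + 1 else 0)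
      then (if i + 1 < n then 1 else \<nu>) * M $$ (k, j) else 0)"
    using assms by (intro sum.cong) (auto simp: shift_mat_def)
  finally show ?thesis using assms by (auto simp: sum.delta)
qed

text \<open>The same collapse along columns: column \<open>j\<close> is supported at row
  \<open>j - 1\<close>, or at the last row when \<open>j = 0\<close>.\<close>

lemma mult_shift_mat_index:
  assumes "M \<in> carrier_mat m n" "i < m" "j < n"
  shows "(M * shift_mat \<nu> n) $$ (i, j) =
    (if j = 0 then \<nu> * M $$ (i, n - 1) else M $$ (i, j - 1))"
proof -
  have "(M * shift_mat \<nu> n) $$ (i, j) = (\<Sum>k = 0..<n. M $$ (i, k) * shift_mat \<nu> n $$ (k, j))"
    using assms by (auto simp: scalar_prod_def intro!: sum.cong)
  also have "\<dots> = (\<Sum>k = 0..<n. if k = (if j = 0 then n - 1 else j - 1)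
      then (if j = 0 then \<nu> else 1) * M $$ (i, k) else 0)"
    using assms by (intro sum.cong) (auto simp: shift_mat_def)
  finally show ?thesis using assms by (auto simp: sum.delta)
qed

text \<open>The matrices commuting with \<open>P\<^sub>\<nu>\<close> are exactly the \<open>\<nu>\<close>-circulant ones; in this form closure under
  products and transposition is matrix algebra.\<close>

definition nu_circulant :: "'a::comm_ring_1 \<Rightarrow> nat \<Rightarrow> 'a mat \<Rightarrow> bool" where
  "nu_circulant \<nu> n M \<longleftrightarrow> M \<in> carrier_mat n n \<and> shift_mat \<nu> n * M = M * shift_mat \<nu> n"

lemma nu_circulant_carrier: "nu_circulant \<nu> n M \<Longrightarrow> M \<in> carrier_mat n n"
  by (simp add: nu_circulant_def)

text \<open>By the two product formulas, commuting means that each entry agrees with its cyclic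
  upper left neighbour, with factors \<open>\<nu>\<close> at the wrap-arounds. The entry formula for
  \<open>circ\<close> has this property.\<close>

lemma nu_circulant_circ:
  assumes v: "v \<in> carrier_vec n"
  shows "nu_circulant \<nu> n (circ \<nu> v)"
proof -
  have C: "circ \<nu> v \<in> carrier_mat n n" using v circ_carrier[of \<nu> v] by simp
  moreover have "shift_mat \<nu> n * circ \<nu> v = circ \<nu> v * shift_mat \<nu> n"
  proof (rule eq_matI)
    fix i j
    assume "i < dim_row (circ \<nu> v * shift_mat \<nu> n)" "j < dim_col (circ \<nu> v * shift_mat \<nu> n)"
    then have ij: "i < n" "j < n" using C by auto
    have dim: "dim_vec v = n" using v by simp
    show "(shift_mat \<nu> n * circ \<nu> v) $$ (i, j) = (circ \<nu> v * shift_mat \<nu> n) $$ (i, j)"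
      unfolding shift_mat_mult_index[OF C ij] mult_shift_mat_index[OF C ij]
    proof (cases "i + 1 < n")
      case False
      \<comment> \<open>In the last row the row index wraps around, and both sides come out as
        \<open>\<nu> * v $ j\<close>.\<close>
      then have "n = Suc i" using ij by simp
      then show "(if i + 1 < n then circ \<nu> v $$ (i + 1, j) else \<nu> * circ \<nu> v $$ (0, j)) =
          (if j = 0 then \<nu> * circ \<nu> v $$ (i, n - 1) else circ \<nu> v $$ (i, j - 1))"
        using ij dim by (cases j) (auto simp: circ_index)
    qed (use ij dim in \<open>cases j; auto simp: circ_index\<close>)
  qed (use C in auto)
  ultimately show ?thesis by (simp add: nu_circulant_def)
qed

text \<open>Comparing entries in the commutation relation expresses row \<open>i + 1\<close> through
  row \<open>i\<close>, so the first row determines the matrix by induction.\<close>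

lemma nu_circulant_eqI:
  assumes M: "nu_circulant \<nu> n M" and N: "nu_circulant \<nu> n N"
    and row: "\<And>j. j < n \<Longrightarrow> M $$ (0, j) = N $$ (0, j)"
  shows "M = N"
proof -
  note carrier = nu_circulant_carrier[OF M] nu_circulant_carrier[OF N]
  have step: "L $$ (Suc i, j) = (if j = 0 then \<nu> * L $$ (i, n - 1) else L $$ (i, j - 1))"
    if L: "nu_circulant \<nu> n L" and "Suc i < n" "j < n" for L i j
    using that shift_mat_mult_index[OF nu_circulant_carrier[OF L], of i j \<nu>]
      mult_shift_mat_index[OF nu_circulant_carrier[OF L], of i j \<nu>]
    by (simp add: nu_circulant_def)
  have "M $$ (i, j) = N $$ (i, j)" if "i < n" "j < n" for i j
    using that by (induction i arbitrary: j) (auto simp: row step[OF M] step[OF N])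
  then show ?thesis using carrier by (intro eq_matI) auto
qed

text \<open>Both sides commute with \<open>P\<^sub>\<nu>\<close> and share their first row. This
  makes the entry formula \<open>circ_index\<close> available for every matrix commuting with
  \<open>P\<^sub>\<nu>\<close>.\<close>

lemma nu_circulant_eq_circ:
  assumes M: "nu_circulant \<nu> n M"
  shows "M = circ \<nu> (row M 0)"
proof (rule nu_circulant_eqI[OF M])
  note carrier = nu_circulant_carrier[OF M]
  show "nu_circulant \<nu> n (circ \<nu> (row M 0))"
    using carrier by (intro nu_circulant_circ) auto
  show "M $$ (0, j) = circ \<nu> (row M 0) $$ (0, j)" if "j < n" for j
    using that carrier by (subst circ_index) auto
qed

lemma nu_circulant_one: "nu_circulant \<nu> n (1\<^sub>m n)"
  by (simp add: nu_circulant_def)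

lemma nu_circulant_smult: "nu_circulant \<nu> n M \<Longrightarrow> nu_circulant \<nu> n (s \<cdot>\<^sub>m M)"
  using mult_smult_distrib[of "shift_mat \<nu> n" n n M n s]
    mult_smult_assoc_mat[of M n n "shift_mat \<nu> n" n s]
  by (simp add: nu_circulant_def)

lemma nu_circulant_add:
  "nu_circulant \<nu> n M \<Longrightarrow> nu_circulant \<nu> n N \<Longrightarrow> nu_circulant \<nu> n (M + N)"
  using mult_add_distrib_mat[of "shift_mat \<nu> n" n n M n N]
    add_mult_distrib_mat[of M n n N "shift_mat \<nu> n" n]
  by (simp add: nu_circulant_def)

lemma nu_circulant_mult:
  assumes M: "nu_circulant \<nu> n M" and N: "nu_circulant \<nu> n N"
  shows "nu_circulant \<nu> n (M * N)"
proof -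
  let ?P = "shift_mat \<nu> n"
  have carrier: "M \<in> carrier_mat n n" "N \<in> carrier_mat n n" "?P \<in> carrier_mat n n"
    and comm: "?P * M = M * ?P" "?P * N = N * ?P"
    using M N by (simp_all add: nu_circulant_def)
  have "?P * (M * N) = (?P * M) * N"
    by (rule assoc_mult_mat[symmetric]) (use carrier in auto)
  also have "\<dots> = M * (?P * N)"
    unfolding comm(1) by (rule assoc_mult_mat) (use carrier in auto)
  also have "\<dots> = M * N * ?P"
    unfolding comm(2) by (rule assoc_mult_mat[symmetric]) (use carrier in auto)
  finally show ?thesis
    unfolding nu_circulant_def using mult_carrier_mat[OF carrier(1,2)] by blast
qed

text \<open>Products stay circulant, so comparing first rows is enough; these are twisted
  convolutions, which are symmetric in the two factors.\<close>

lemma nu_circulant_commute: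
  assumes M: "nu_circulant \<nu> n M" and N: "nu_circulant \<nu> n N"
  shows "M * N = N * M"
proof (rule nu_circulant_eqI[OF nu_circulant_mult[OF M N] nu_circulant_mult[OF N M]])
  note carrier = nu_circulant_carrier[OF M] nu_circulant_carrier[OF N]
  fix j assume j: "j < n"
  have sums: "(K * L) $$ (0, j) = (\<Sum>k = 0..<n. K $$ (0, k) *
      (if k \<le> j then L $$ (0, j - k) else \<nu> * L $$ (0, n + j - k)))"
    if K: "nu_circulant \<nu> n K" and L: "nu_circulant \<nu> n L" for K L
  proof -
    note KL = nu_circulant_carrier[OF K] nu_circulant_carrier[OF L]
    have "L $$ (k, j) = (if k \<le> j then L $$ (0, j - k) else \<nu> * L $$ (0, n + j - k))"
      if "k < n" for k
      using that j KL by (subst nu_circulant_eq_circ[OF L], subst circ_index) auto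
    then show ?thesis using KL j by (auto simp: scalar_prod_def intro!: sum.cong)
  qed
  \<comment> \<open>The substitution is \<open>k \<mapsto> j - k\<close> modulo \<open>n\<close>, an
    involution that exchanges the two factors. It preserves the wrapped range \<open>k > j\<close>,
    so the factor \<open>\<nu>\<close> appears in matching terms.\<close>
  show "(M * N) $$ (0, j) = (N * M) $$ (0, j)"
    unfolding sums[OF M N] sums[OF N M]
    by (rule sum.reindex_bij_witness[where i = "\<lambda>k. if k \<le> j then j - k else n + j - k"
          and j = "\<lambda>k. if k \<le> j then j - k else n + j - k"])
      (use j in \<open>auto simp: mult.commute mult.left_commute\<close>)
qed

text \<open>Transposing the commutation relation shows that \<open>M\<^sup>T\<close> commutes with
  the transpose of \<open>P\<^sub>\<nu>\<close>. As \<open>\<nu> * \<rho> = 1\<close>, that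
  transpose is the inverse of \<open>P\<^sub>\<rho>\<close>, and commuting with an inverse is the
  same as commuting with the matrix.\<close>

lemma nu_circulant_transpose:
  assumes \<nu>: "\<nu> * \<rho> = 1" and M: "nu_circulant \<nu> n M"
  shows "nu_circulant \<rho> n (M\<^sup>T)"
proof -
  let ?P = "shift_mat \<rho> n" and ?Q = "(shift_mat \<nu> n)\<^sup>T"
  note carrier = nu_circulant_carrier[OF M] shift_mat_carrier[of \<rho> n] shift_mat_carrier[of \<nu> n]
  have Q: "?Q \<in> carrier_mat n n" and MT: "M\<^sup>T \<in> carrier_mat n n" using carrier by auto
  have PQ: "?P * ?Q = 1\<^sub>m n"
  proof (rule eq_matI)
    fix i j assume "i < dim_row (1\<^sub>m n :: 'a mat)" "j < dim_col (1\<^sub>m n :: 'a mat)"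
    then have ij: "i < n" "j < n" by auto
    show "(?P * ?Q) $$ (i, j) = 1\<^sub>m n $$ (i, j)"
      unfolding shift_mat_mult_index[OF Q ij] using ij \<nu>
      by (auto simp: shift_mat_def mult.commute)
  qed auto
  then have QP: "?Q * ?P = 1\<^sub>m n" using mat_mult_one_commute carrier(2) Q by blast
  have QM: "M\<^sup>T * ?Q = ?Q * M\<^sup>T"
    using M carrier transpose_mult[of "shift_mat \<nu> n" n n M n] transpose_mult[of M n n "shift_mat \<nu> n" n]
    by (simp add: nu_circulant_def)
  have "?P * M\<^sup>T = ?P * M\<^sup>T * (?Q * ?P)" using carrier MT by (simp add: QP)
  also have "\<dots> = ?P * (M\<^sup>T * ?Q) * ?P"
    using carrier MT Q by (simp add: assoc_mult_mat[of _ n n _ n _ n] mult_carrier_mat[of _ n n _ n])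
  also have "\<dots> = (?P * ?Q) * M\<^sup>T * ?P"
    unfolding QM using carrier MT Q by (simp add: assoc_mult_mat[of _ n n _ n _ n] mult_carrier_mat[of _ n n _ n])
  also have "\<dots> = M\<^sup>T * ?P" using MT by (simp add: PQ)
  finally show ?thesis using MT by (simp add: nu_circulant_def)
qed

section \<open>The exchange matrix and block diagonal matrices\<close>

lemma exchange_mat_carrier [simp]: "exchange_mat n \<in> carrier_mat n n"
  by (simp add: exchange_mat_def)

lemma transpose_exchange_mat [simp]: "(exchange_mat n)\<^sup>T = exchange_mat n"
  by (rule eq_matI) (auto simp: exchange_mat_def add.commute)

lemma exchange_mat_mult_self [simp]:
  "exchange_mat n * exchange_mat n = (1\<^sub>m n :: 'a::comm_ring_1 mat)"
proof (rule eq_matI)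
  fix i j assume "i < dim_row (1\<^sub>m n :: 'a mat)" "j < dim_col (1\<^sub>m n :: 'a mat)"
  then have ij: "i < n" "j < n" by auto
  have "(exchange_mat n * exchange_mat n) $$ (i, j) =
      (\<Sum>k = 0..<n. exchange_mat n $$ (i, k) * (exchange_mat n $$ (k, j) :: 'a))"
    using ij by (simp add: scalar_prod_def exchange_mat_def)
  \<comment> \<open>Only \<open>k = n - 1 - i\<close> satisfies \<open>i + k + 1 = n\<close>, and
    for it \<open>k + j + 1 = n\<close> holds iff \<open>i = j\<close>.\<close>
  also have "\<dots> = (\<Sum>k = 0..<n. if k = n - 1 - i then if i = j then 1 else 0 else 0)"
    using ij by (intro sum.cong) (auto simp: exchange_mat_def)
  finally show "(exchange_mat n * exchange_mat n) $$ (i, j) = (1\<^sub>m n :: 'a mat) $$ (i, j)"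
    using ij by (simp add: sum.delta)
qed (auto simp: exchange_mat_def)

lemma four_block_diag_eq_minus_one_iff:
  fixes P Q :: "'a::comm_ring_1 mat"
  assumes P: "P \<in> carrier_mat n n" and Q: "Q \<in> carrier_mat m m"
  shows "four_block_mat P (0\<^sub>m n m) (0\<^sub>m m n) Q = - 1\<^sub>m (n + m) \<longleftrightarrow> P = - 1\<^sub>m n \<and> Q = - 1\<^sub>m m"
    (is "?F = _ \<longleftrightarrow> _")
proof
  assume eq: "?F = - 1\<^sub>m (n + m)"
  have "P $$ (i, j) = - 1\<^sub>m n $$ (i, j)" if "i < n" "j < n" for i j
    using arg_cong[OF eq, of "\<lambda>M. M $$ (i, j)"] that P Q by simp
  moreover have "Q $$ (i, j) = - 1\<^sub>m m $$ (i, j)" if "i < m" "j < m" for i j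
    using arg_cong[OF eq, of "\<lambda>M. M $$ (n + i, n + j)"] that P Q by simp
  ultimately show "P = - 1\<^sub>m n \<and> Q = - 1\<^sub>m m"
    using P Q by (intro conjI eq_matI) simp_all
next
  assume "P = - 1\<^sub>m n \<and> Q = - 1\<^sub>m m"
  moreover have "four_block_mat (- 1\<^sub>m n) (0\<^sub>m n m) (0\<^sub>m m n) (- 1\<^sub>m m) = (- 1\<^sub>m (n + m) :: 'a mat)"
    by (rule eq_matI) auto
  ultimately show "?F = - 1\<^sub>m (n + m)" by simp
qed

section \<open>Conjugation, Hermitian circulants and \<Theta>\<close>

context ring_involution
begin

lemma adj_mult:
  "M \<in> carrier_mat k l \<Longrightarrow> N \<in> carrier_mat l m \<Longrightarrow> adj (M * N) = adj N * adj M"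
  by (simp add: mat_hom_mult[of _ k l _ m] transpose_mult[of _ k l _ m])

lemma adj_add:
  "M \<in> carrier_mat k l \<Longrightarrow> N \<in> carrier_mat k l \<Longrightarrow> adj (M + N) = adj M + adj N"
  by (rule eq_matI) (auto simp: hom_add)

text \<open>With \<open>N\<close> the conjugate of \<open>M\<close>, the product is
  \<open>N N\<^sup>*\<close>, hence Hermitian.\<close>

lemma adj_mult_transpose_self:
  assumes "M \<in> carrier_mat k l"
  shows "adj (mat\<^sub>h M * M\<^sup>T) = mat\<^sub>h M * M\<^sup>T"
proof -
  have "adj (mat\<^sub>h M * M\<^sup>T) = adj (M\<^sup>T) * adj (mat\<^sub>h M)"
    by (rule adj_mult) (use assms in auto)
  also have "\<dots> = mat\<^sub>h M * M\<^sup>T" by (simp add: map_mat_transpose)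
  finally show ?thesis .
qed

lemma mat_hom_uminus: "mat\<^sub>h (- M) = - mat\<^sub>h M"
  by (rule eq_matI) (auto simp: hom_uminus)

lemma mat_hom_exchange_mat [simp]: "mat\<^sub>h (exchange_mat n) = exchange_mat n"
  by (rule eq_matI) (auto simp: exchange_mat_def)

lemma nu_circulant_mat_hom:
  assumes M: "nu_circulant \<nu> n M"
  shows "nu_circulant (hom \<nu>) n (mat\<^sub>h M)"
proof -
  have "shift_mat (hom \<nu>) n = mat\<^sub>h (shift_mat \<nu> n)"
    by (rule eq_matI) (auto simp: shift_mat_def)
  then show ?thesis
    using M by (auto simp: nu_circulant_def simp flip: mat_hom_mult[of _ n n _ n])
qed

text \<open>In a Hermitian \<open>\<nu>\<close>-circulant matrix the entries \<open>(j, 0)\<close> and \<open>(n - j, 0)\<close> determine each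
  other, so half of the first column suffices.\<close>

lemma hermitian_nu_circulant_eq_scalar_iff:
  assumes n: "n \<ge> 1" and H: "nu_circulant \<nu> n H" and herm: "adj H = H" and s: "hom s = s"
  shows "H = s \<cdot>\<^sub>m 1\<^sub>m n \<longleftrightarrow> (\<forall>j\<in>{0..n div 2}. H $$ (j, 0) = (if j = 0 then s else 0))"
proof
  assume "H = s \<cdot>\<^sub>m 1\<^sub>m n"
  with n show "\<forall>j\<in>{0..n div 2}. H $$ (j, 0) = (if j = 0 then s else 0)"
    by (auto simp: div_less_dividend intro: le_less_trans)
next
  assume half: "\<forall>j\<in>{0..n div 2}. H $$ (j, 0) = (if j = 0 then s else 0)"
  note carrier = nu_circulant_carrier[OF H]
  have flip: "H $$ (0, j) = hom (H $$ (j, 0))" if "j < n" for j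
    using that carrier arg_cong[OF herm, of "\<lambda>M. M $$ (0, j)"] n by simp
  have col: "H $$ (j, 0) = (if j = 0 then s else 0)" if j: "j < n" for j
  proof (cases "j \<le> n div 2")
    case False
    \<comment> \<open>Here \<open>0 < n - j\<close> and \<open>n - j \<le> n div 2\<close>, so the
      reflected entry is one of those assumed to vanish.\<close>
    then have "H $$ (j, 0) = \<nu> * H $$ (0, n - j)"
      using j n carrier by (subst nu_circulant_eq_circ[OF H], subst circ_index) auto
    also have "H $$ (0, n - j) = hom (H $$ (n - j, 0))" using False j by (intro flip) auto
    also have "H $$ (n - j, 0) = 0" using half False j by auto
    finally show ?thesis using False by auto
  qed (use half in auto)
  \<comment> \<open>The first row is the conjugate of the first column, and \<open>s\<close> is
    fixed by the involution.\<close>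
  show "H = s \<cdot>\<^sub>m 1\<^sub>m n"
    by (rule nu_circulant_eqI[OF H nu_circulant_smult[OF nu_circulant_one]])
      (use flip col s n in auto)
qed

text \<open>The entry pairs the conjugate of row \<open>j\<close> with row 0. Row \<open>j\<close>
  is the first row moved right by \<open>j\<close> places, and its wrapped entries
  \<open>k < j\<close>, which carry \<open>\<nu>\<close>, give the second sum of
  \<open>Theta\<close>.\<close>

lemma Theta_eq_index:
  assumes a: "a \<in> carrier_vec n" and j: "j < n"
  shows "Theta a (vec\<^sub>h a) j (hom \<nu>) = (mat\<^sub>h (circ \<nu> a) * (circ \<nu> a)\<^sup>T) $$ (j, 0)"
proof -
  have C: "circ \<nu> a \<in> carrier_mat n n" using a circ_carrier[of \<nu> a] by simp
  have dim: "dim_vec a = n" using a by simp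
  have "(mat\<^sub>h (circ \<nu> a) * (circ \<nu> a)\<^sup>T) $$ (j, 0) =
      (\<Sum>k = 0..<n. hom (circ \<nu> a $$ (j, k)) * circ \<nu> a $$ (0, k))"
    using C j by (auto simp: scalar_prod_def intro!: sum.cong)
  also have "\<dots> = (\<Sum>k = 0..<n. hom (if j \<le> k then a $ (k - j) else \<nu> * a $ (n + k - j)) * a $ k)"
    using j dim by (intro sum.cong) (auto simp: circ_index)
  also have "\<dots> = (\<Sum>k = 0..<j. hom \<nu> * (hom (a $ (n + k - j)) * a $ k)) +
      (\<Sum>k = j..<n. hom (a $ (k - j)) * a $ k)"
    using j by (subst sum.atLeastLessThan_concat[of 0 j n, symmetric])
      (auto simp: hom_mult mult.assoc intro!: arg_cong2[of _ _ _ _ "(+)"] sum.cong)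
  \<comment> \<open>The substitution \<open>i = n + k - j\<close> carries the wrapped range onto the
    last \<open>j\<close> indices; the remaining range is shifted by
    \<open>i = k - j\<close>.\<close>
  also have "(\<Sum>k = 0..<j. hom \<nu> * (hom (a $ (n + k - j)) * a $ k)) =
      (\<Sum>i = n - j..<n. hom \<nu> * (a $ ((i + j) mod n) * vec\<^sub>h a $ i))"
  proof (rule sum.reindex_bij_witness[where i = "\<lambda>i. i + j - n" and j = "\<lambda>k. n + k - j"])
    fix k assume k: "k \<in> {0..<j}"
    then have "(n + k - j + j) mod n = k" using j by simp
    then show "hom \<nu> * (a $ ((n + k - j + j) mod n) * vec\<^sub>h a $ (n + k - j)) =
        hom \<nu> * (hom (a $ (n + k - j)) * a $ k)"
      using k j dim by (simp add: mult.commute)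
  qed (use j in auto)
  also have "(\<Sum>k = j..<n. hom (a $ (k - j)) * a $ k) =
      (\<Sum>i = 0..<n - j. a $ ((i + j) mod n) * vec\<^sub>h a $ i)"
    by (rule sum.reindex_bij_witness[where i = "\<lambda>i. i + j" and j = "\<lambda>k. k - j"])
      (use j dim in \<open>auto simp: mult.commute\<close>)
  finally show ?thesis
    by (simp add: Theta_def dim sum_distrib_left add.commute)
qed

section \<open>The block product \<open>X\<^sup>* X\<close>\<close>

text \<open>Commutation of \<open>A\<close> and \<open>B\<close> cancels the off-diagonal blocks.
  The upper left block is \<open>V\<^sup>* H V\<close> with \<open>V = C J\<close>, and the lower
  right block is \<open>H\<close>.\<close>

lemma adj_block_mult_eq_minus_one_iff:
  assumes carrier: "A \<in> carrier_mat n n" "B \<in> carrier_mat n n" "C \<in> carrier_mat n n"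
      "J \<in> carrier_mat n n"
    and J: "adj J = J" "J * J = 1\<^sub>m n"
    and AB: "A * B = B * A" and A: "mat\<^sub>h A * A\<^sup>T = A\<^sup>T * mat\<^sub>h A"
    and B: "mat\<^sub>h B * B\<^sup>T = B\<^sup>T * mat\<^sub>h B"
    and X: "X = four_block_mat (- (A\<^sup>T * C * J)) (- mat\<^sub>h B) (B\<^sup>T * C * J) (- mat\<^sub>h A)"
  shows "adj X * X = - 1\<^sub>m (n + n) \<longleftrightarrow>
    mat\<^sub>h A * A\<^sup>T + mat\<^sub>h B * B\<^sup>T = - 1\<^sub>m n \<and> mat\<^sub>h C * C\<^sup>T = 1\<^sub>m n"
proof -
  let ?H = "mat\<^sub>h A * A\<^sup>T + mat\<^sub>h B * B\<^sup>T" and ?W = "J * adj C" and ?V = "C * J"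
  note assoc = assoc_mult_mat[of _ n n _ n _ n] mult_carrier_mat[of _ n n _ n]
  have cs: "mat\<^sub>h A \<in> carrier_mat n n" "mat\<^sub>h B \<in> carrier_mat n n" "A\<^sup>T \<in> carrier_mat n n"
    "B\<^sup>T \<in> carrier_mat n n" "adj C \<in> carrier_mat n n" "?W \<in> carrier_mat n n" "?V \<in> carrier_mat n n"
    "?H \<in> carrier_mat n n"
    using carrier by auto
  have AV: "A\<^sup>T * ?V \<in> carrier_mat n n" "B\<^sup>T * ?V \<in> carrier_mat n n"
    using cs by (auto intro: mult_carrier_mat)
  have X': "X = four_block_mat (- (A\<^sup>T * ?V)) (- mat\<^sub>h B) (B\<^sup>T * ?V) (- mat\<^sub>h A)"
    unfolding X using carrier by (simp add: assoc)
  have adj_V: "adj ?V = ?W" using carrier J by (simp add: adj_mult[of _ n n _ n])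
  have adj_XV: "adj (M\<^sup>T * ?V) = ?W * mat\<^sub>h M" if "M \<in> carrier_mat n n" for M
    using adj_mult[of "M\<^sup>T" n n ?V n] that cs(7) by (simp only: adj_V) (simp add: map_mat_transpose)
  have adj_mat_hom: "adj (mat\<^sub>h M) = M\<^sup>T" for M by simp
  have adj_uminus: "adj (- M) = - adj M" for M by (simp add: mat_hom_uminus transpose_uminus)
  have "mat\<^sub>h X = four_block_mat (mat\<^sub>h (- (A\<^sup>T * ?V))) (mat\<^sub>h (- mat\<^sub>h B))
      (mat\<^sub>h (B\<^sup>T * ?V)) (mat\<^sub>h (- mat\<^sub>h A))"
    unfolding X' by (rule map_four_block_mat[of _ n n _ n _ n]) (use carrier AV in auto)
  then have "adj X = four_block_mat (adj (- (A\<^sup>T * ?V))) (adj (B\<^sup>T * ?V)) (adj (- mat\<^sub>h B)) (adj (- mat\<^sub>h A))"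
    by (simp only:, intro transpose_four_block_mat[of _ n n _ n _ n]) (use carrier AV in auto)
  also have "\<dots> = four_block_mat (- (?W * mat\<^sub>h A)) (?W * mat\<^sub>h B) (- B\<^sup>T) (- A\<^sup>T)"
    unfolding adj_uminus adj_XV[OF carrier(1)] adj_XV[OF carrier(2)] adj_mat_hom ..
  finally have adj_X: "adj X = \<dots>" .
  \<comment> \<open>The transposed relation cancels the lower left block, the conjugated one the
    upper right block.\<close>
  have TT: "A\<^sup>T * B\<^sup>T = B\<^sup>T * A\<^sup>T"
    using carrier AB transpose_mult[of A n n B n] transpose_mult[of B n n A n] by simp
  have hh: "mat\<^sub>h A * mat\<^sub>h B = mat\<^sub>h B * mat\<^sub>h A"
    using carrier AB mat_hom_mult[of A n n B n] mat_hom_mult[of B n n A n] by simp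
  have add_uminus: "M + - M = 0\<^sub>m n n" if "M \<in> carrier_mat n n" for M :: "'a mat"
    using that by (intro eq_matI) auto
  have b11: "- (?W * mat\<^sub>h A) * - (A\<^sup>T * ?V) + ?W * mat\<^sub>h B * (B\<^sup>T * ?V) = ?W * ?H * ?V"
    using cs by (simp add: assoc mult_add_distrib_mat[of _ n n _ n] add_mult_distrib_mat[of _ n n _ _ n])
  have b12: "- (?W * mat\<^sub>h A) * - mat\<^sub>h B + ?W * mat\<^sub>h B * - mat\<^sub>h A = 0\<^sub>m n n"
  proof -
    have "?W * mat\<^sub>h A * mat\<^sub>h B = ?W * (mat\<^sub>h A * mat\<^sub>h B)"
      by (rule assoc_mult_mat) (use cs in auto)
    also have "\<dots> = ?W * mat\<^sub>h B * mat\<^sub>h A"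
      unfolding hh by (rule assoc_mult_mat[symmetric]) (use cs in auto)
    finally have eq: "?W * mat\<^sub>h A * mat\<^sub>h B = ?W * mat\<^sub>h B * mat\<^sub>h A" .
    have "?W * mat\<^sub>h B * mat\<^sub>h A \<in> carrier_mat n n" using cs carrier by (intro mult_carrier_mat)
    then show ?thesis using cs by (simp add: eq add_uminus del: assoc_mult_mat)
  qed
  have b21: "- B\<^sup>T * - (A\<^sup>T * ?V) + - A\<^sup>T * (B\<^sup>T * ?V) = 0\<^sub>m n n"
  proof -
    have "A\<^sup>T * (B\<^sup>T * ?V) = (A\<^sup>T * B\<^sup>T) * ?V"
      by (rule assoc_mult_mat[symmetric]) (use cs in auto)
    also have "\<dots> = B\<^sup>T * (A\<^sup>T * ?V)"
      unfolding TT by (rule assoc_mult_mat) (use cs in auto)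
    finally have eq: "A\<^sup>T * (B\<^sup>T * ?V) = B\<^sup>T * (A\<^sup>T * ?V)" .
    have "B\<^sup>T * (A\<^sup>T * ?V) \<in> carrier_mat n n" using cs carrier by (intro mult_carrier_mat)
    then show ?thesis using cs by (simp add: eq add_uminus del: assoc_mult_mat)
  qed
  \<comment> \<open>The product is \<open>B\<^sup>T B\<^sup>c + A\<^sup>T A\<^sup>c\<close>; the
    commutation of each conjugate with the transpose turns it into \<open>H\<close>.\<close>
  have b22: "- B\<^sup>T * - mat\<^sub>h B + - A\<^sup>T * - mat\<^sub>h A = ?H"
    using cs by (simp add: A B comm_add_mat[of _ n n])
  have "adj X * X = four_block_mat
      (- (?W * mat\<^sub>h A) * - (A\<^sup>T * ?V) + ?W * mat\<^sub>h B * (B\<^sup>T * ?V))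
      (- (?W * mat\<^sub>h A) * - mat\<^sub>h B + ?W * mat\<^sub>h B * - mat\<^sub>h A)
      (- B\<^sup>T * - (A\<^sup>T * ?V) + - A\<^sup>T * (B\<^sup>T * ?V))
      (- B\<^sup>T * - mat\<^sub>h B + - A\<^sup>T * - mat\<^sub>h A)"
    unfolding adj_X
    by (subst X', rule mult_four_block_mat[of _ n n _ n _ n _ _ n _ n])
      (intro uminus_carrier_mat mult_carrier_mat[of _ n n _ n] carrier cs)+
  then have diag: "adj X * X = four_block_mat (?W * ?H * ?V) (0\<^sub>m n n) (0\<^sub>m n n) ?H"
    unfolding b11 b12 b21 b22 .
  have WHV: "?W * ?H * ?V \<in> carrier_mat n n"
    by (intro mult_carrier_mat[of _ n n _ n] cs)
  have "adj X * X = - 1\<^sub>m (n + n) \<longleftrightarrow> ?W * ?H * ?V = - 1\<^sub>m n \<and> ?H = - 1\<^sub>m n"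
    unfolding diag by (rule four_block_diag_eq_minus_one_iff[OF WHV cs(8)])
  \<comment> \<open>Since the other block already demands \<open>H = -I\<close>, the upper left
    block may be studied under this assumption, where it is
    \<open>- J C\<^sup>* C J\<close>.\<close>
  moreover have "?W * ?H * ?V = - 1\<^sub>m n \<longleftrightarrow> mat\<^sub>h C * C\<^sup>T = 1\<^sub>m n" if H: "?H = - 1\<^sub>m n"
  proof -
    let ?D = "adj C * C"
    have D: "?D \<in> carrier_mat n n" "J * ?D \<in> carrier_mat n n"
      by (intro mult_carrier_mat[of _ n n _ n] carrier cs)+
    have "?W * ?V = ?W * C * J"
      by (rule assoc_mult_mat[symmetric, of _ n n _ n _ n]) (fact cs carrier)+
    also have "?W * C = J * ?D"
      by (rule assoc_mult_mat[of _ n n _ n _ n]) (fact cs carrier)+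
    finally have WV: "?W * ?V = J * ?D * J" .
    have "?W * ?H * ?V = - (?W * ?V)"
      unfolding H using cs by (simp del: assoc_mult_mat)
    then have WHV: "?W * ?H * ?V = - (J * ?D * J)"
      unfolding WV .
    \<comment> \<open>Conjugating by \<open>J\<close> a second time recovers \<open>D\<close>, so
      \<open>J D J = I\<close> iff \<open>D = I\<close>.\<close>
    have "J * (J * ?D * J) * J = J * (J * ?D) * J * J"
      by (subst assoc_mult_mat[symmetric, of J n n "J * ?D" n J n]) (fact D carrier refl)+
    also have "\<dots> = J * (J * ?D) * (J * J)"
      by (rule assoc_mult_mat[of _ n n _ n _ n]) (intro mult_carrier_mat[of _ n n _ n] D carrier)+
    also have "J * (J * ?D) = (J * J) * ?D"
      by (rule assoc_mult_mat[symmetric, of _ n n _ n _ n]) (fact D carrier)+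
    finally have JJ: "J * (J * ?D * J) * J = ?D"
      unfolding J(2) left_mult_one_mat[OF D(1)] right_mult_one_mat[OF D(1)] .
    have "?W * ?H * ?V = - 1\<^sub>m n \<longleftrightarrow> J * (adj C * C) * J = 1\<^sub>m n"
      unfolding WHV by (metis uminus_uminus_mat)
    also have "\<dots> \<longleftrightarrow> adj C * C = 1\<^sub>m n"
    proof
      assume "J * (adj C * C) * J = 1\<^sub>m n"
      then have "adj C * C = J * 1\<^sub>m n * J" using JJ by simp
      then show "adj C * C = 1\<^sub>m n" using J(2) carrier(4) by simp
    next
      assume "adj C * C = 1\<^sub>m n"
      then show "J * (adj C * C) * J = 1\<^sub>m n" using J(2) carrier(4) by simp
    qed
    \<comment> \<open>Exchanging the factors and then conjugating entrywise gives
      \<open>C\<^sup>c C\<^sup>T\<close>, whose first column holds the values of \<Theta>.\<close>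
    also have "\<dots> \<longleftrightarrow> C * adj C = 1\<^sub>m n"
      using mat_mult_one_commute[OF carrier(3) cs(5)] mat_mult_one_commute[OF cs(5) carrier(3)]
      by blast
    also have "\<dots> \<longleftrightarrow> mat\<^sub>h (C * adj C) = mat\<^sub>h (1\<^sub>m n)"
      by (metis mat_hom_mat_hom)
    also have "mat\<^sub>h (C * adj C) = mat\<^sub>h C * C\<^sup>T"
      using carrier by (simp add: mat_hom_mult[of _ n n _ n] map_mat_transpose)
    finally show ?thesis by (simp add: mat_hom_one)
  qed
  ultimately show ?thesis by blast
qed

end

section \<open>From the involution to the conditions on \<Theta>\<close>

text \<open>The carrier of \<open>class_ring\<close> is the whole type, so the homomorphism laws
  hold for all elements; preservation of zero follows from additivity.\<close>

lemma ring_involution_of_nontrivial_involution: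
  fixes \<sigma> :: "'a::comm_ring_1 \<Rightarrow> 'a"
  assumes "nontrivial_involution (class_ring :: 'a ring) \<sigma>"
  shows "ring_involution \<sigma>"
proof -
  have hom: "\<sigma> \<in> Ring.ring_hom (class_ring :: 'a ring) class_ring" and inv: "\<sigma> (\<sigma> x) = x" for x
    using assms by (auto simp: nontrivial_involution_def ring_iso_def)
  have add: "\<sigma> (x + y) = \<sigma> x + \<sigma> y" for x y using Ring.ring_hom_add[OF hom] by simp
  have "\<sigma> 0 = 0" using add[of 0 0] by simp
  then show ?thesis
    using add Ring.ring_hom_mult[OF hom] Ring.ring_hom_one[OF hom] inv by unfold_locales simp_all
qed

theorem theorem1:
  fixes \<sigma> :: "'a::comm_ring_1 \<Rightarrow> 'a"
    and n :: nat
    and lam mu :: 'a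
    and a b c :: "'a vec"
    and A B C J X G :: "'a mat"
  assumes "comm_frobenius_ring (class_ring :: 'a ring)"
    and "nontrivial_involution (class_ring :: 'a ring) \<sigma>"
    and "n \<ge> 1"
    and "lam * \<sigma> lam = 1" and "mu * \<sigma> mu = 1"
    and "a \<in> carrier_vec n" and "b \<in> carrier_vec n" and "c \<in> carrier_vec n"
    and "A = circ lam a" and "B = circ lam b" and "C = circ mu c"
    and "J = exchange_mat n"
    and "X = four_block_mat
               (- (A\<^sup>T * C * J)) (- map_mat \<sigma> B)
               (B\<^sup>T * C * J)     (- map_mat \<sigma> A)"
    and "G = append_cols (1\<^sub>m (2 * n)) X"
  shows "hermitian_self_dual \<sigma> (4 * n) (row_module G) \<longleftrightarrow>
    (\<forall>j\<in>{0..n div 2}.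
       Theta a (map_vec \<sigma> a) j (\<sigma> lam) + Theta b (map_vec \<sigma> b) j (\<sigma> lam)
         = (if j = 0 then -1 else 0)) \<and>
    (\<forall>j\<in>{0..n div 2}.
       Theta c (map_vec \<sigma> c) j (\<sigma> mu) = (if j = 0 then 1 else 0))"
proof -
  interpret ring_involution \<sigma> by (rule ring_involution_of_nontrivial_involution) fact
  let ?H = "map_mat \<sigma> A * A\<^sup>T + map_mat \<sigma> B * B\<^sup>T" and ?K = "map_mat \<sigma> C * C\<^sup>T"
  have A: "nu_circulant lam n A" and B: "nu_circulant lam n B" and C: "nu_circulant mu n C"
    using assms nu_circulant_circ by auto
  note carrier = nu_circulant_carrier[OF A] nu_circulant_carrier[OF B] nu_circulant_carrier[OF C]
  \<comment> \<open>As \<open>\<sigma> lam\<close> is the inverse of \<open>lam\<close>, conjugation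
    and transposition both lead to circulants for \<open>\<sigma> lam\<close>, so their results
    commute.\<close>
  note A' = nu_circulant_mat_hom[OF A] nu_circulant_transpose[OF assms(4) A]
  note B' = nu_circulant_mat_hom[OF B] nu_circulant_transpose[OF assms(4) B]
  note C' = nu_circulant_mat_hom[OF C] nu_circulant_transpose[OF assms(5) C]
  have J: "J \<in> carrier_mat n n" using assms(12) by simp
  have X: "X \<in> carrier_mat (n + n) (n + n)"
    unfolding assms(13) using carrier J by (intro four_block_carrier_mat) auto
  have H: "nu_circulant (\<sigma> lam) n ?H" and K: "nu_circulant (\<sigma> mu) n ?K"
    using A' B' C' by (simp_all add: nu_circulant_add nu_circulant_mult)
  have "adj ?H = adj (map_mat \<sigma> A * A\<^sup>T) + adj (map_mat \<sigma> B * B\<^sup>T)"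
    by (rule adj_add[of _ n n]) (use carrier in auto)
  then have adj_H: "adj ?H = ?H"
    unfolding adj_mult_transpose_self[OF carrier(1)] adj_mult_transpose_self[OF carrier(2)] .
  have dims: "4 * n = (n + n) + (n + n)" "2 * n = n + n" by simp_all
  have "hermitian_self_dual \<sigma> (4 * n) (row_module G) \<longleftrightarrow> adj X * X = - 1\<^sub>m (n + n)"
    unfolding assms(14) dims by (rule hermitian_self_dual_iff[OF X])
  also have "\<dots> \<longleftrightarrow> ?H = - 1\<^sub>m n \<and> ?K = 1\<^sub>m n"
    by (rule adj_block_mult_eq_minus_one_iff[OF carrier J _ _ nu_circulant_commute[OF A B]
          nu_circulant_commute[OF A'] nu_circulant_commute[OF B'] assms(13)])
      (simp_all add: assms(12))
  \<comment> \<open>The scalar form with \<open>s = -1\<close>, a value fixed by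
    \<open>\<sigma>\<close>, makes the half-column criterion applicable.\<close>
  also have "?H = - 1\<^sub>m n \<longleftrightarrow> ?H = (- 1) \<cdot>\<^sub>m 1\<^sub>m n"
    by (rule arg_cong[of _ _ "(=) ?H"], rule eq_matI) auto
  also have "\<dots> \<longleftrightarrow> (\<forall>j\<in>{0..n div 2}. ?H $$ (j, 0) = (if j = 0 then - 1 else 0))"
    by (rule hermitian_nu_circulant_eq_scalar_iff[OF assms(3) H adj_H]) (simp add: hom_uminus)
  also have "?K = 1\<^sub>m n \<longleftrightarrow> ?K = 1 \<cdot>\<^sub>m 1\<^sub>m n"
    by (rule arg_cong[of _ _ "(=) ?K"], rule eq_matI) auto
  also have "\<dots> \<longleftrightarrow> (\<forall>j\<in>{0..n div 2}. ?K $$ (j, 0) = (if j = 0 then 1 else 0))"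
    by (rule hermitian_nu_circulant_eq_scalar_iff[OF assms(3) K adj_mult_transpose_self[OF carrier(3)]])
      simp
  also have "(\<forall>j\<in>{0..n div 2}. ?H $$ (j, 0) = (if j = 0 then - 1 else 0)) \<longleftrightarrow>
      (\<forall>j\<in>{0..n div 2}. Theta a (map_vec \<sigma> a) j (\<sigma> lam) + Theta b (map_vec \<sigma> b) j (\<sigma> lam)
        = (if j = 0 then - 1 else 0))"
  proof (rule ball_cong)
    fix j assume "j \<in> {0..n div 2}"
    \<comment> \<open>For \<open>n \<ge> 1\<close> the bound \<open>n div 2\<close> stays below
      \<open>n\<close>, so the entry \<open>(j, 0)\<close> exists.\<close>
    then have "j < n" using assms(3) by auto
    then have "?H $$ (j, 0) = Theta a (map_vec \<sigma> a) j (\<sigma> lam) + Theta b (map_vec \<sigma> b) j (\<sigma> lam)"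
      using carrier assms(3) Theta_eq_index[OF assms(6), of j lam] Theta_eq_index[OF assms(7), of j lam]
      unfolding assms(9,10) by simp
    then show "?H $$ (j, 0) = (if j = 0 then - 1 else 0) \<longleftrightarrow>
        Theta a (map_vec \<sigma> a) j (\<sigma> lam) + Theta b (map_vec \<sigma> b) j (\<sigma> lam)
          = (if j = 0 then - 1 else 0)"
      by (simp only:)
  qed simp
  also have "(\<forall>j\<in>{0..n div 2}. ?K $$ (j, 0) = (if j = 0 then 1 else 0)) \<longleftrightarrow>
      (\<forall>j\<in>{0..n div 2}. Theta c (map_vec \<sigma> c) j (\<sigma> mu) = (if j = 0 then 1 else 0))"
  proof (rule ball_cong)
    fix j assume "j \<in> {0..n div 2}"
    then have "j < n" using assms(3) by auto
    then show "?K $$ (j, 0) = (if j = 0 then 1 else 0) \<longleftrightarrow>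
        Theta c (map_vec \<sigma> c) j (\<sigma> mu) = (if j = 0 then 1 else 0)"
      using Theta_eq_index[OF assms(8), of j mu] unfolding assms(11) by (simp only:)
  qed simp
  finally show ?thesis .
qed

end
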